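(* Fix a prime power $q$ and an integer $\alpha\ge 2$. For positive integers $k,m,t$ with $k-m-t=\alpha$, let $$K=\frac{q}{2}\begin{bmatrix}k-t+1\\ 1\end{bmatrix}_q\begin{bmatrix}k-t\\ 1\end{bmatrix}_q,\qquad F=\begin{bmatrix}k-t+1\\ m+1\end{bmatrix}_q\frac{\prod_{i=0}^{m}(q^{m+1}-q^{i})}{(m+1)!\,(q-1)^{m+1}},$$ $$\frac{M}{N}=1-q^{2(m+1)}\,\frac{\begin{bmatrix}k-m-t\\ 1\end{bmatrix}_q\begin{bmatrix}k-m-t-1\\ 1\end{bmatrix}_q}{\begin{bmatrix}k-t+1\\ 1\end{bmatrix}_q\begin{bmatrix}k-t\\ 1\end{bmatrix}_q},\qquad R=\frac{q^{2m+3}}{(m+2)(m+3)}\begin{bmatrix}k-m-t\\ 1\end{bmatrix}_q\begin{bmatrix}k-m-t-1\\ 1\end{bmatrix}_q$$ (these are the number of users, subpacketization, cached fraction and rate of a coded caching scheme). Then $\frac{M}{N}\le \frac{2}{q^{\alpha-1}}$, and as $k-t\to\infty$ (equivalently $K\to\infty$), with $q$ and $\alpha$ constant, $$F=q^{O((\log_q K)^2)}\qquad\text{and}\qquad R=\Theta\!\left(\frac{K}{(\log_q K)^2}\right).$$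
   Context: For integers $a\ge b\ge 1$, $\begin{bmatrix}a\\ b\end{bmatrix}_q=\frac{(q^a-1)(q^{a-1}-1)\cdots(q^{a-b+1}-1)}{(q^b-1)(q^{b-1}-1)\cdots(q-1)}$, and $\begin{bmatrix}a\\ 0\end{bmatrix}_q=1$. Since $k-m-t=\alpha$, all four quantities $K,F,\frac{M}{N},R$ depend only on $q$, $\alpha$ and $k-t=m+\alpha$; the symbol $\frac{M}{N}$ is treated as a single quantity. The constants implied by $O$ and $\Theta$ may depend on $q$ and $\alpha$. *)

theory Defs
  imports
    Complex_Main
    "HOL-Library.Landau_Symbols"
    "HOL-Number_Theory.Prime_Powers"
begin

(* Intended for b <= a. Both products run over i = 0, ..., b - 1; for b = 0 they are empty
   and the value is 1. *)
definition gauss_binomial :: "nat \<Rightarrow> nat \<Rightarrow> nat \<Rightarrow> real" where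
  "gauss_binomial q a b =
     (\<Prod>i<b. (real q ^ (a - i) - 1)) / (\<Prod>i<b. (real q ^ (b - i) - 1))"

(* The equation k - m - t = alpha is written additively, so that it entails t <= k and
   m <= k - t; hence no subtraction on nat below is truncated on admissible triples
   when alpha >= 1. *)
definition admissible :: "nat \<Rightarrow> (nat \<times> nat \<times> nat) set" where
  "admissible \<alpha> = {(k, m, t). k > 0 \<and> m > 0 \<and> t > 0 \<and> k = m + t + \<alpha>}"

definition num_users :: "nat \<Rightarrow> nat \<Rightarrow> nat \<Rightarrow> nat \<Rightarrow> real" where
  "num_users q k m t =
     real q / 2 * gauss_binomial q (k - t + 1) 1 * gauss_binomial q (k - t) 1"

definition subpacketization :: "nat \<Rightarrow> nat \<Rightarrow> nat \<Rightarrow> nat \<Rightarrow> real" where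
  "subpacketization q k m t =
     gauss_binomial q (k - t + 1) (m + 1) *
       ((\<Prod>i=0..m. (real q ^ (m + 1) - real q ^ i)) / (fact (m + 1) * (real q - 1) ^ (m + 1)))"

definition cached_fraction :: "nat \<Rightarrow> nat \<Rightarrow> nat \<Rightarrow> nat \<Rightarrow> real" where
  "cached_fraction q k m t =
     1 - real q ^ (2 * (m + 1)) *
       ((gauss_binomial q (k - m - t) 1 * gauss_binomial q (k - m - t - 1) 1) /
        (gauss_binomial q (k - t + 1) 1 * gauss_binomial q (k - t) 1))"

definition rate :: "nat \<Rightarrow> nat \<Rightarrow> nat \<Rightarrow> nat \<Rightarrow> real" where
  "rate q k m t =
     real q ^ (2 * m + 3) / ((real m + 2) * (real m + 3)) *
       gauss_binomial q (k - m - t) 1 * gauss_binomial q (k - m - t - 1) 1"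

(* The limits k - t -> infinity and K -> infinity along admissible triples; nothing else is
   assumed about how k, m and t vary, so asymptotic bounds are uniform over all
   admissible triples with large k - t (resp. large K). *)
definition diff_to_infinity :: "nat \<Rightarrow> (nat \<times> nat \<times> nat) filter" where
  "diff_to_infinity \<alpha> =
     inf (filtercomap (\<lambda>(k, m, t). k - t) at_top) (principal (admissible \<alpha>))"

definition users_to_infinity :: "nat \<Rightarrow> nat \<Rightarrow> (nat \<times> nat \<times> nat) filter" where
  "users_to_infinity q \<alpha> =
     inf (filtercomap (\<lambda>(k, m, t). num_users q k m t) at_top) (principal (admissible \<alpha>))"

lemma diff_to_infinity_neq_bot: "diff_to_infinity \<alpha> \<noteq> bot"
proof
  assume "diff_to_infinity \<alpha> = bot"
  then have "eventually (\<lambda>_. False) (diff_to_infinity \<alpha>)" by simp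
  then obtain n where n: "\<And>k m t. k - t \<ge> n \<Longrightarrow> (k, m, t) \<notin> admissible \<alpha>"
    unfolding diff_to_infinity_def eventually_inf_principal eventually_filtercomap
      eventually_at_top_linorder by fastforce
  show False using n[of "Suc n + 1 + \<alpha>" 1 "Suc n"]
    using n[of "Suc n + 1 + \<alpha>" "Suc n" 1] by (simp add: admissible_def)
qed

end

(* Put n = k - t. Then q^n <= K <= q^(2n+2), so log_q K has the order of n. Absorbing the
   denominator of the Gaussian binomial into the second product gives
     F = \<Prod>i\<le>m. q^i / (i + 1) * (q^(n+1-i) - 1) / (q - 1),
   in which every factor lies between 1 and q^(2(n+1)); hence 0 <= log_q F = O(n^2).
   Finally R = 2 K (1 - M/N) / ((m + 2) (m + 3)), where
   1 - M/N = (q^(n+1) - q^(m+1)) (q^n - q^(m+1)) / ((q^(n+1) - 1) (q^n - 1))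
   lies between (1 - q^(-alpha)) (1 - q^(-(alpha-1))) and 1. *)

theory Submission
  imports Defs
begin

section \<open>Growth of the number of users K\<close>

lemma gauss_binomial_1: "gauss_binomial q a 1 = (real q ^ a - 1) / (real q - 1)"
  by (simp add: gauss_binomial_def)

text \<open>The quotient (x^(n+1) - 1) / (x - 1) is the geometric sum 1 + x + ... + x^n, which is at
  least its top term. The upper bound rests on x - 1 \<ge> 1. These two bounds are the only size
  estimates for Gaussian binomials used below.\<close>

lemma geometric_quotient_bounds:
  fixes x :: real
  assumes "x \<ge> 2"
  shows "x ^ n \<le> (x ^ Suc n - 1) / (x - 1)" "(x ^ n - 1) / (x - 1) \<le> x ^ n"
proof -
  have 1: "x ^ n \<ge> 1" using assms by simp
  then show "x ^ n \<le> (x ^ Suc n - 1) / (x - 1)"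
    using assms by (simp add: field_simps)
  have "x ^ n * 1 \<le> x ^ n * (x - 1)"
    using assms 1 by (intro mult_left_mono) auto
  then have "x ^ n - 1 \<le> x ^ n * (x - 1)" by linarith
  then show "(x ^ n - 1) / (x - 1) \<le> x ^ n"
    using assms by (simp only: pos_divide_le_eq)
qed

text \<open>Turns a lower bound on K into one on k - t when the two limits are compared.\<close>

lemma num_users_mono:
  assumes "q \<ge> 2" "k' - t' \<le> k - t"
  shows "num_users q k' m' t' \<le> num_users q k m t"
proof -
  have q: "real q \<ge> 2" using assms by simp
  have "gauss_binomial q a 1 \<le> gauss_binomial q b 1" if "a \<le> b" for a b
    unfolding gauss_binomial_1 using q that
    by (intro divide_right_mono diff_right_mono power_increasing) auto
  moreover have "gauss_binomial q a 1 \<ge> 0" for a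
    unfolding gauss_binomial_1 using q by simp
  ultimately show ?thesis
    unfolding num_users_def using assms by (intro mult_mono) auto
qed

lemma num_users_bounds:
  assumes "q \<ge> 2" "k - t \<ge> 1"
  shows "real q ^ (k - t) \<le> num_users q k m t"
    and "num_users q k m t \<le> real q ^ (2 * (k - t) + 2)"
proof -
  define x where "x = real q"
  have x: "x \<ge> 2" using assms by (simp add: x_def)
  obtain n where n: "k - t = Suc n" using assms by (cases "k - t") auto
  have K: "num_users q k m t =
      x / 2 * ((x ^ Suc (Suc n) - 1) / (x - 1)) * ((x ^ Suc n - 1) / (x - 1))"
    by (simp only: num_users_def gauss_binomial_1 n x_def Suc_eq_plus1)
  \<comment> \<open>The quotients in K are at least x^(n+1) and x^n, and x / 2 \<ge> 1. The factor
    x^n is given away, since only the order of log K matters.\<close>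
  have "x ^ Suc n * 1 \<le> x ^ Suc n * x ^ n"
    using x by (intro mult_left_mono) auto
  also have "\<dots> \<le> x / 2 * x ^ Suc n * x ^ n"
    using x by (intro mult_right_mono) auto
  also have "\<dots> \<le> num_users q k m t"
    unfolding K using x
    by (intro mult_mono mult_nonneg_nonneg geometric_quotient_bounds(1)[OF x]
        divide_nonneg_nonneg one_le_power diff_ge_0_iff_ge[THEN iffD2]) auto
  finally show "real q ^ (k - t) \<le> num_users q k m t"
    by (simp add: n x_def)
  have "num_users q k m t \<le> x * x ^ Suc (Suc n) * x ^ Suc n"
    unfolding K using x one_le_power[of x "Suc n"] one_le_power[of x "Suc (Suc n)"]
    by (intro mult_mono mult_nonneg_nonneg divide_nonneg_nonneg
        geometric_quotient_bounds(2)[OF x]) auto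
  also have "\<dots> = x ^ (2 * (k - t) + 2)"
    by (simp add: n power_add mult_2)
  finally show "num_users q k m t \<le> real q ^ (2 * (k - t) + 2)"
    by (simp add: x_def)
qed

lemma log_num_users_bounds:
  assumes "q \<ge> 2" "k - t \<ge> 1"
  shows "real (k - t) \<le> log (real q) (num_users q k m t)"
    and "log (real q) (num_users q k m t) \<le> 4 * real (k - t)"
proof -
  have q: "real q > 1" using assms by simp
  have K: "num_users q k m t > 0"
    by (rule less_le_trans[OF _ num_users_bounds(1)[OF assms]]) (use q in simp)
  show "real (k - t) \<le> log (real q) (num_users q k m t)"
    using num_users_bounds(1)[OF assms, of m] q K by (simp add: le_log_iff powr_realpow)
  have "log (real q) (num_users q k m t) \<le> real (2 * (k - t) + 2)"
    using num_users_bounds(2)[OF assms, of m] q K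
    by (subst log_le_iff) (simp_all only: powr_realpow)
  \<comment> \<open>2(k - t) + 2 \<le> 4(k - t) because k - t \<ge> 1.\<close>
  also have "\<dots> \<le> real (4 * (k - t))"
    by (subst of_nat_le_iff) (use assms(2) in linarith)
  finally show "log (real q) (num_users q k m t) \<le> 4 * real (k - t)"
    by simp
qed

section \<open>Equivalence of the limits k - t \<rightarrow> \<infinity> and K \<rightarrow>
  \<infinity>\<close>

lemma eventually_diff_to_infinity:
  "eventually P (diff_to_infinity \<alpha>) \<longleftrightarrow>
     (\<exists>N. \<forall>k m t. (k, m, t) \<in> admissible \<alpha> \<longrightarrow> k - t \<ge> N \<longrightarrow> P (k, m, t))"
  by (fastforce simp: diff_to_infinity_def eventually_inf_principal
      eventually_filtercomap_at_top_linorder)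

lemma eventually_users_to_infinity:
  "eventually P (users_to_infinity q \<alpha>) \<longleftrightarrow>
     (\<exists>C. \<forall>k m t. (k, m, t) \<in> admissible \<alpha> \<longrightarrow> num_users q k m t \<ge> C \<longrightarrow> P (k, m, t))"
  by (fastforce simp: users_to_infinity_def eventually_inf_principal
      eventually_filtercomap_at_top_linorder)

text \<open>K is a nondecreasing function of k - t and dominates q^(k-t), so each quantity is large
  as soon as the other is.\<close>

lemma diff_to_infinity_eq_users_to_infinity:
  assumes "q \<ge> 2"
  shows "diff_to_infinity \<alpha> = users_to_infinity q \<alpha>"
proof (rule filter_eqI)
  fix P
  show "eventually P (diff_to_infinity \<alpha>) \<longleftrightarrow> eventually P (users_to_infinity q \<alpha>)"
  proof
    assume "eventually P (diff_to_infinity \<alpha>)"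
    then obtain N where
      N: "\<And>k m t. (k, m, t) \<in> admissible \<alpha> \<Longrightarrow> k - t \<ge> N \<Longrightarrow> P (k, m, t)"
      unfolding eventually_diff_to_infinity by blast
    \<comment> \<open>\<open>num_users q N 0 0\<close> is the value of K at k - t = N; adding 1
      makes k - t < N contradictory by monotonicity.\<close>
    have "P (k, m, t)"
      if adm: "(k, m, t) \<in> admissible \<alpha>" and K: "num_users q k m t \<ge> num_users q N 0 0 + 1"
      for k m t
    proof (rule N[OF adm], rule ccontr)
      assume "\<not> N \<le> k - t"
      then have "num_users q k m t \<le> num_users q N 0 0"
        using assms by (intro num_users_mono) auto
      with K show False by simp
    qed
    then show "eventually P (users_to_infinity q \<alpha>)"
      unfolding eventually_users_to_infinity by blast
  next
    assume "eventually P (users_to_infinity q \<alpha>)"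
    then obtain C where
      C: "\<And>k m t. (k, m, t) \<in> admissible \<alpha> \<Longrightarrow> num_users q k m t \<ge> C \<Longrightarrow> P (k, m, t)"
      unfolding eventually_users_to_infinity by blast
    obtain N where N: "real q ^ N > C"
      using assms real_arch_pow[of "real q" C] by auto
    \<comment> \<open>\<open>Suc N\<close> rather than \<open>N\<close> secures k - t \<ge> 1, which
      the lower bound on K requires.\<close>
    have "P (k, m, t)" if adm: "(k, m, t) \<in> admissible \<alpha>" and n: "k - t \<ge> Suc N" for k m t
    proof (rule C[OF adm])
      have "C \<le> real q ^ N" using N by simp
      also have "\<dots> \<le> real q ^ (k - t)"
        using assms n by (intro power_increasing) auto
      also have "\<dots> \<le> num_users q k m t"
        using assms n by (intro num_users_bounds) auto
      finally show "C \<le> num_users q k m t" .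
    qed
    then show "eventually P (diff_to_infinity \<alpha>)"
      unfolding eventually_diff_to_infinity by blast
  qed
qed

section \<open>The cached fraction M/N\<close>

lemma cached_fraction_bounds:
  assumes "q \<ge> 2" "\<alpha> \<ge> 2" "(k, m, t) \<in> admissible \<alpha>"
  shows "0 \<le> cached_fraction q k m t"
    and "(1 - 1 / real q ^ \<alpha>) * (1 - 1 / real q ^ (\<alpha> - 1)) \<le> 1 - cached_fraction q k m t"
proof -
  define x where "x = real q"
  have x: "x \<ge> 2" using assms by (simp add: x_def)
  obtain b where b: "\<alpha> = Suc b" using assms by (cases \<alpha>) auto
  have k: "k = m + t + Suc b" using assms(3) by (simp add: admissible_def b)
  \<comment> \<open>With u = q^(m+1), the exponents k - t + 1 and k - t give u q^\<alpha> and u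
    q^(\<alpha>-1), and the prefactor q^(2(m+1)) is u squared.\<close>
  define u where "u = x ^ Suc m"
  have u: "u \<ge> 1" using x unfolding u_def by (intro one_le_power) auto
  have p: "x ^ Suc b \<ge> 1" "x ^ b \<ge> 1" using x by (intro one_le_power; simp)+
  have b0: "x ^ b > 1" using assms(2) x by (intro one_less_power) (auto simp: b)
  have up: "1 * (x ^ Suc b) \<le> u * x ^ Suc b" "1 * (x ^ b) \<le> u * x ^ b"
    using u x by (intro mult_right_mono; simp)+
  have p': "x ^ Suc b > 1" using x by (intro one_less_power) auto
  define D where "D = (u * x ^ Suc b - 1) * (u * x ^ b - 1)"
  have up1: "u * x ^ Suc b > 1" "u * x ^ b > 1" using up p' b0 by linarith+
  then have D: "D > 0"
    unfolding D_def by (intro mult_pos_pos) linarith+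
  have eq: "1 - cached_fraction q k m t = (u * x ^ Suc b - u) * (u * x ^ b - u) / D"
  proof -
    have "k - t + 1 = Suc m + Suc b" "k - t = Suc m + b" "k - m - t = Suc b" "k - m - t - 1 = b"
      by (simp_all add: k)
    then have "1 - cached_fraction q k m t = u ^ 2 *
        (((x ^ Suc b - 1) / (x - 1) * ((x ^ b - 1) / (x - 1))) /
         ((u * x ^ Suc b - 1) / (x - 1) * ((u * x ^ b - 1) / (x - 1))))"
      by (simp only: cached_fraction_def gauss_binomial_1 flip: x_def)
        (simp only: u_def power_add Suc_eq_plus1 power_mult mult.commute[of 2] algebra_simps)
    also have "\<dots> = u ^ 2 * (((x ^ Suc b - 1) * (x ^ b - 1)) / D)"
      using x by (simp add: D_def)
    finally show ?thesis by (simp add: power2_eq_square algebra_simps)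
  qed
  \<comment> \<open>Since u \<ge> 1, subtracting u instead of 1 makes each factor smaller.\<close>
  have "(u * x ^ Suc b - u) * (u * x ^ b - u) \<le> D"
    unfolding D_def using up1 up p u by (intro mult_mono) (auto simp: mult_le_cancel_left1)
  then show "0 \<le> cached_fraction q k m t"
    using eq D by (smt (verit) divide_le_eq_1_pos)
  \<comment> \<open>Dropping both -1 terms enlarges the denominator; afterwards u cancels from each
    factor, leaving 1 - 1/y with y = q^\<alpha> and y = q^(\<alpha>-1).\<close>
  have "D \<le> (u * x ^ Suc b) * (u * x ^ b)"
    unfolding D_def using up1 by (intro mult_mono) linarith+
  moreover have "(u * x ^ Suc b - u) * (u * x ^ b - u) \<ge> 0"
    using u p by (intro mult_nonneg_nonneg) auto
  ultimately have "(u * x ^ Suc b - u) * (u * x ^ b - u) / ((u * x ^ Suc b) * (u * x ^ b))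
      \<le> 1 - cached_fraction q k m t"
    unfolding eq using D by (intro divide_left_mono) auto
  moreover have "(u * x ^ Suc b - u) * (u * x ^ b - u) / ((u * x ^ Suc b) * (u * x ^ b))
      = (u * x ^ Suc b - u) / (u * x ^ Suc b) * ((u * x ^ b - u) / (u * x ^ b))"
    by (rule times_divide_times_eq[symmetric])
  moreover have "(u * y - u) / (u * y) = 1 - 1 / y" if "y \<ge> 1" for y
    using that u by (simp add: field_simps)
  ultimately show
    "(1 - 1 / real q ^ \<alpha>) * (1 - 1 / real q ^ (\<alpha> - 1)) \<le> 1 - cached_fraction q k m t"
    using p by (simp only: b x_def diff_Suc_1)
qed

text \<open>With a = q^(-\<alpha>) and b = q^(-(\<alpha>-1)), expanding (1 - a)(1 - b) gives M/N
  \<le> a + b - ab, and a \<le> b.\<close>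

lemma cached_fraction_le:
  assumes "q \<ge> 2" "\<alpha> \<ge> 2" "(k, m, t) \<in> admissible \<alpha>"
  shows "cached_fraction q k m t \<le> 2 / real q ^ (\<alpha> - 1)"
proof -
  have "1 / real q ^ \<alpha> \<le> 1 / real q ^ (\<alpha> - 1)"
    using assms by (intro divide_left_mono power_increasing) auto
  moreover have "1 / real q ^ \<alpha> * (1 / real q ^ (\<alpha> - 1)) \<ge> 0" by simp
  ultimately show ?thesis
    using cached_fraction_bounds(2)[OF assms]
    \<comment> \<open>Writing 2/y as 1/y + 1/y makes the goal linear in a, b and ab.\<close>
    unfolding left_diff_distrib right_diff_distrib
      add_divide_distrib[of 1 1 "real q ^ (\<alpha> - 1)", unfolded one_add_one]
    by linarith
qed

section \<open>The rate R\<close>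

text \<open>The Gaussian binomials in K cancel the denominator of 1 - M/N, and q * q^(2(m+1)) =
  q^(2m+3). So bounds on R reduce to those on M/N and m.\<close>

lemma rate_eq:
  assumes "q \<ge> 2" "k - t \<ge> 1"
  shows "rate q k m t =
    2 * num_users q k m t * (1 - cached_fraction q k m t) / ((real m + 2) * (real m + 3))"
proof -
  have "gauss_binomial q a 1 \<noteq> 0" if "a \<ge> 1" for a
  proof -
    have "real q ^ a > 1" using assms(1) that by (intro one_less_power) auto
    then show ?thesis using assms(1) by (simp add: gauss_binomial_1 del: One_nat_def)
  qed
  with assms show ?thesis
    by (simp add: rate_def num_users_def cached_fraction_def numeral_eq_Suc field_simps)
qed

text \<open>1 - M/N lies in [1/4, 1], and (m + 2)(m + 3) has the order of (log K)^2 because log K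
  lies between m + \<alpha> and 4(m + \<alpha>).\<close>

lemma rate_bounds:
  assumes "q \<ge> 2" "\<alpha> \<ge> 2" "(k, m, t) \<in> admissible \<alpha>"
  defines "S \<equiv> num_users q k m t / (log (real q) (num_users q k m t))\<^sup>2"
  shows "1 / 4 * S \<le> rate q k m t" "rate q k m t \<le> 32 * (real \<alpha>)\<^sup>2 * S"
proof -
  define n where "n = k - t"
  define K where "K = num_users q k m t"
  define L where "L = log (real q) K"
  define \<rho> where "\<rho> = 1 - cached_fraction q k m t"
  define A where "A = (real m + 2) * (real m + 3)"
  have nm: "n = m + \<alpha>" "m \<ge> 1" "k - t = m + \<alpha>" using assms(3) by (auto simp: admissible_def n_def)
  have n1: "k - t \<ge> 1" using nm by simp
  have L: "real n \<le> L" "L \<le> 4 * real n"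
    unfolding L_def K_def n_def using log_num_users_bounds[OF assms(1) n1] by auto
  have L0: "L > 0" using L nm by simp
  have K: "K > 0"
    unfolding K_def
    by (rule less_le_trans[OF _ num_users_bounds(1)[OF assms(1) n1]]) (use assms(1) in simp)
  have A: "A > 0" by (simp add: A_def)
  have R: "rate q k m t = 2 * K * \<rho> / A"
    unfolding K_def \<rho>_def A_def by (rule rate_eq[OF assms(1) n1])
  have half: "1 - 1 / real q ^ i \<ge> 1 / 2" if "i \<ge> 1" for i
  proof -
    have "(2::real) ^ 1 \<le> 2 ^ i" using that by (intro power_increasing) auto
    also have "\<dots> \<le> real q ^ i" using assms(1) by (intro power_mono) auto
    finally have "1 / real q ^ i \<le> 1 / 2" using assms(1) by (intro divide_left_mono) auto
    then show ?thesis by simp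
  qed
  \<comment> \<open>Both exponents \<alpha> and \<alpha> - 1 are at least 1, so each factor is at
    least 1/2.\<close>
  have "1 / 2 * (1 / 2) \<le> (1 - 1 / real q ^ \<alpha>) * (1 - 1 / real q ^ (\<alpha> - 1))"
    using assms(2) by (intro mult_mono half order_trans[OF _ half]) auto
  also have "\<dots> \<le> \<rho>"
    unfolding \<rho>_def by (rule cached_fraction_bounds[OF assms(1-3)])
  finally have \<rho>: "1 / 4 \<le> \<rho>" by simp
  have \<rho>1: "\<rho> \<le> 1"
    unfolding \<rho>_def using cached_fraction_bounds(1)[OF assms(1-3)] by simp
  have S: "S = K / L\<^sup>2" by (simp add: S_def K_def L_def)
  \<comment> \<open>m + 2 \<le> m + \<alpha> \<le> \<open>L\<close> and m + 3 \<le> 2(m + \<alpha>)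
    \<le> 2 \<open>L\<close>, using \<alpha> \<ge> 2.\<close>
  have "A \<le> L * (2 * L)"
    unfolding A_def using L nm assms(2) by (intro mult_mono) auto
  then have "K / (L * (2 * L)) \<le> K / A"
    using K A L0 by (intro divide_left_mono) auto
  then have "1 / 4 * S \<le> 2 * K * (1 / 4) / A"
    by (simp add: S power2_eq_square)
  also have "\<dots> \<le> rate q k m t"
    unfolding R using K A \<rho> by (intro divide_right_mono mult_left_mono) auto
  finally show "1 / 4 * S \<le> rate q k m t" .
  \<comment> \<open>m + \<alpha> \<le> \<alpha>(m + 1): this is where the constant of the upper
    bound picks up its dependence on \<alpha>.\<close>
  have "real n \<le> real (\<alpha> * (m + 1))"
    using assms(2) nm by (subst of_nat_le_iff) simp
  then have nA: "real n \<le> real \<alpha> * (real m + 1)" by (simp add: algebra_simps)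
  then have L': "L \<le> 4 * real \<alpha> * (real m + 1)" using L by simp
  have "L * L \<le> (4 * real \<alpha> * (real m + 1)) * (4 * real \<alpha> * (real m + 1))"
    using L' L0 by (intro mult_mono) auto
  also have "\<dots> = 16 * (real \<alpha>)\<^sup>2 * ((real m + 1) * (real m + 1))"
    by (simp add: power2_eq_square)
  also have "\<dots> \<le> 16 * (real \<alpha>)\<^sup>2 * A"
    unfolding A_def by (intro mult_left_mono mult_mono) auto
  finally have LA: "L\<^sup>2 \<le> 16 * (real \<alpha>)\<^sup>2 * A" by (simp add: power2_eq_square)
  have "rate q k m t \<le> 2 * K * 1 / A"
    unfolding R using K A \<rho>1 by (intro divide_right_mono mult_left_mono) auto
  also have "\<dots> = 2 * K * L\<^sup>2 / (A * L\<^sup>2)"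
    using L0 by simp
  also have "\<dots> \<le> 2 * K * (16 * (real \<alpha>)\<^sup>2 * A) / (A * L\<^sup>2)"
    using LA K A by (intro divide_right_mono mult_left_mono) auto
  also have "\<dots> = 32 * (real \<alpha>)\<^sup>2 * S"
    using A by (simp add: S)
  finally show "rate q k m t \<le> 32 * (real \<alpha>)\<^sup>2 * S" .
qed

section \<open>The subpacketization F\<close>

lemma subpacketization_eq_prod:
  assumes "q \<ge> 2"
  shows "subpacketization q k m t = (\<Prod>i<Suc m.
    real q ^ i / real (Suc i) * ((real q ^ (k - t + 1 - i) - 1) / (real q - 1)))"
proof -
  define x where "x = real q"
  have x: "x \<ge> 2" using assms by (simp add: x_def)
  define P where "P = (\<Prod>i<Suc m. x ^ (Suc m - i) - 1)"
  have "x ^ (Suc m - i) - 1 \<noteq> 0" if "i < Suc m" for i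
  proof -
    have "x ^ (Suc m - i) > 1" using x that by (intro one_less_power) auto
    then show ?thesis by linarith
  qed
  then have P: "P \<noteq> 0" by (simp add: P_def del: prod.lessThan_Suc)
  \<comment> \<open>Pulling x^i out of each factor leaves exactly the denominator \<open>P\<close>
    of the Gaussian binomial.\<close>
  have "(\<Prod>i<Suc m. x ^ Suc m - x ^ i) = (\<Prod>i<Suc m. x ^ i * (x ^ (Suc m - i) - 1))"
    by (intro prod.cong refl)
      (simp add: right_diff_distrib less_Suc_eq_le flip: power_Suc power_add)
  then have num: "(\<Prod>i<Suc m. x ^ Suc m - x ^ i) = (\<Prod>i<Suc m. x ^ i) * P"
    by (simp only: P_def prod.distrib)
  have fct: "(\<Prod>i<Suc m. real (Suc i)) = fact (Suc m)"
    by (simp only: fact_prod_Suc of_nat_prod flip: atLeast0LessThan)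
  have "subpacketization q k m t = (\<Prod>i<Suc m. x ^ (k - t + 1 - i) - 1) / P *
      ((\<Prod>i<Suc m. x ^ i) * P / (fact (Suc m) * (x - 1) ^ Suc m))"
    unfolding subpacketization_def gauss_binomial_def Suc_eq_plus1[symmetric] atLeast0AtMost
      lessThan_Suc_atMost[symmetric] x_def[symmetric] num P_def[symmetric] by (rule refl)
  also have "\<dots> = (\<Prod>i<Suc m. x ^ i) / fact (Suc m) *
      ((\<Prod>i<Suc m. x ^ (k - t + 1 - i) - 1) / (x - 1) ^ Suc m)"
    using P by (simp del: prod.lessThan_Suc fact_Suc power_Suc)
  \<comment> \<open>The factorial and the power of x - 1 are distributed, one \<open>Suc i\<close>
    and one x - 1 to each factor.\<close>
  also have "\<dots> = (\<Prod>i<Suc m. x ^ i / real (Suc i) * ((x ^ (k - t + 1 - i) - 1) / (x - 1)))"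
    by (simp only: prod.distrib prod_dividef fct prod_constant card_lessThan)
  finally show ?thesis by (simp only: x_def)
qed

lemma subpacketization_bounds:
  assumes "q \<ge> 2" "(k, m, t) \<in> admissible \<alpha>"
  shows "1 \<le> subpacketization q k m t"
    and "subpacketization q k m t \<le> real q ^ (8 * (k - t)\<^sup>2)"
proof -
  define x where "x = real q"
  have x: "x \<ge> 2" using assms by (simp add: x_def)
  define n where "n = k - t"
  have n: "n \<ge> m" "n \<ge> 1" using assms(2) by (auto simp: admissible_def n_def)
  define f where "f i = x ^ i / real (Suc i) * ((x ^ (n + 1 - i) - 1) / (x - 1))" for i
  have F: "subpacketization q k m t = prod f {..<Suc m}"
    unfolding f_def n_def x_def by (rule subpacketization_eq_prod[OF assms(1)])
  have low: "1 \<le> f i" and up: "f i \<le> x ^ (2 * (n + 1))" if "i < Suc m" for i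
  proof -
    \<comment> \<open>The share \<open>Suc i\<close> of the factorial is compensated by x^i \<ge>
      2^i.\<close>
    have "Suc i \<le> 2 ^ i" by (simp add: Suc_le_eq)
    then have "real (Suc i) \<le> real (2 ^ i)" by (simp only: of_nat_le_iff)
    also have "\<dots> = 2 ^ i" by simp
    also have "\<dots> \<le> x ^ i" using x by (intro power_mono) auto
    finally have a: "1 \<le> x ^ i / real (Suc i)" by simp
    have "1 \<le> x ^ (n - i)" using x by simp
    also have "\<dots> \<le> (x ^ (n + 1 - i) - 1) / (x - 1)"
      using geometric_quotient_bounds(1)[OF x, of "n - i"] that n by (simp add: Suc_diff_le)
    finally have b: "1 \<le> (x ^ (n + 1 - i) - 1) / (x - 1)" .
    show "1 \<le> f i" unfolding f_def using mult_mono[OF a b] a by simp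
    have "x ^ i / real (Suc i) \<le> x ^ i / 1"
      using x by (intro divide_left_mono) auto
    also have "\<dots> \<le> x ^ (n + 1)"
      unfolding div_by_1 using x that n by (intro power_increasing) auto
    finally have c: "x ^ i / real (Suc i) \<le> x ^ (n + 1)" .
    have "(x ^ (n + 1 - i) - 1) / (x - 1) \<le> x ^ (n + 1 - i)"
      by (rule geometric_quotient_bounds(2)[OF x])
    also have "\<dots> \<le> x ^ (n + 1)"
      using x by (intro power_increasing) auto
    finally have "f i \<le> x ^ (n + 1) * x ^ (n + 1)"
      unfolding f_def using c b x by (intro mult_mono) auto
    then show "f i \<le> x ^ (2 * (n + 1))" by (simp only: mult_2 power_add)
  qed
  show "1 \<le> subpacketization q k m t"
    unfolding F by (rule prod_ge_1) (use low in auto)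
  have "prod f {..<Suc m} \<le> (\<Prod>i<Suc m. x ^ (2 * (n + 1)))"
    using low up by (intro prod_mono) (auto intro: order_trans[OF zero_le_one])
  also have "\<dots> = x ^ (2 * (n + 1) * Suc m)"
    by (simp only: prod_constant card_lessThan power_mult)
  also have "\<dots> \<le> x ^ (8 * n\<^sup>2)"
  proof (rule power_increasing)
    \<comment> \<open>There are m + 1 \<le> 2n factors, each at most x^(4n); this gives the exponent
      8 n^2.\<close>
    have "2 * (n + 1) \<le> 4 * n" "Suc m \<le> 2 * n" using n by auto
    then have "2 * (n + 1) * Suc m \<le> (4 * n) * (2 * n)" by (rule mult_le_mono)
    then show "2 * (n + 1) * Suc m \<le> 8 * n\<^sup>2" by (simp add: power2_eq_square)
  qed (use x in simp)
  finally show "subpacketization q k m t \<le> real q ^ (8 * (k - t)\<^sup>2)"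
    by (simp only: F x_def n_def)
qed

text \<open>log F \<le> 8 (k - t)^2 and k - t \<le> log K. Nonnegativity lets the norm be dropped in
  the O-estimate.\<close>

lemma log_subpacketization_bounds:
  assumes "q \<ge> 2" "(k, m, t) \<in> admissible \<alpha>"
  shows "0 \<le> log (real q) (subpacketization q k m t)"
    and "log (real q) (subpacketization q k m t) \<le> 8 * (log (real q) (num_users q k m t))\<^sup>2"
proof -
  note F = subpacketization_bounds[OF assms]
  have q: "real q > 1" using assms by simp
  have n1: "k - t \<ge> 1" using assms(2) by (auto simp: admissible_def)
  show "0 \<le> log (real q) (subpacketization q k m t)"
    using F(1) q by simp
  have "log (real q) (subpacketization q k m t) \<le> real (8 * (k - t)\<^sup>2)"
    using F q by (subst log_le_iff) (simp_all only: powr_realpow)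
  also have "\<dots> = 8 * (real (k - t))\<^sup>2" by simp
  also have "\<dots> \<le> 8 * (log (real q) (num_users q k m t))\<^sup>2"
    using log_num_users_bounds(1)[OF assms(1) n1] by (intro mult_left_mono power_mono) auto
  finally show
    "log (real q) (subpacketization q k m t) \<le> 8 * (log (real q) (num_users q k m t))\<^sup>2" .
qed

section \<open>Assembly of the asymptotic statements\<close>

theorem mainTheorem2:
  fixes q \<alpha> :: nat
  assumes "primepow q" and "\<alpha> \<ge> 2"
  shows "(\<forall>(k, m, t) \<in> admissible \<alpha>. cached_fraction q k m t \<le> 2 / real q ^ (\<alpha> - 1))
    \<and> diff_to_infinity \<alpha> = users_to_infinity q \<alpha>
    \<and> (\<exists>g \<in> O[diff_to_infinity \<alpha>](\<lambda>(k, m, t). (log (real q) (num_users q k m t))\<^sup>2).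
         \<forall>\<^sub>F (k, m, t) in diff_to_infinity \<alpha>.
           subpacketization q k m t = real q powr (g (k, m, t)))
    \<and> (\<lambda>(k, m, t). rate q k m t) \<in> \<Theta>[diff_to_infinity \<alpha>](\<lambda>(k, m, t).
         num_users q k m t / (log (real q) (num_users q k m t))\<^sup>2)"
proof (intro conjI)
  have q: "q \<ge> 2" using primepow_gt_Suc_0[OF assms(1)] by simp
  \<comment> \<open>The estimates hold at every admissible triple, so no threshold on k - t has to
    be chosen.\<close>
  have ev: "eventually P (diff_to_infinity \<alpha>)"
    if "\<And>k m t. (k, m, t) \<in> admissible \<alpha> \<Longrightarrow> P (k, m, t)" for P
    unfolding eventually_diff_to_infinity by (intro exI allI impI that)
  have K: "num_users q k m t \<ge> 0" if "(k, m, t) \<in> admissible \<alpha>" for k m t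
  proof -
    have "0 \<le> real q ^ (k - t)" by simp
    also have "\<dots> \<le> num_users q k m t"
      using that by (intro num_users_bounds(1)[OF q]) (auto simp: admissible_def)
    finally show ?thesis .
  qed
  show "\<forall>(k, m, t) \<in> admissible \<alpha>. cached_fraction q k m t \<le> 2 / real q ^ (\<alpha> - 1)"
    using cached_fraction_le[OF q assms(2)] by auto
  show "diff_to_infinity \<alpha> = users_to_infinity q \<alpha>"
    by (rule diff_to_infinity_eq_users_to_infinity[OF q])
  \<comment> \<open>The exponent of F in base q; since F \<ge> 1, raising q to it recovers F
    exactly.\<close>
  define g where "g = (\<lambda>(k, m, t). log (real q) (subpacketization q k m t))"
  have "g \<in> O[diff_to_infinity \<alpha>](\<lambda>(k, m, t). (log (real q) (num_users q k m t))\<^sup>2)"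
    by (rule bigoI[where c = 8], rule ev)
      (use log_subpacketization_bounds[OF q] in \<open>auto simp: g_def\<close>)
  moreover have "\<forall>\<^sub>F (k, m, t) in diff_to_infinity \<alpha>.
      subpacketization q k m t = real q powr (g (k, m, t))"
  proof (rule ev, unfold prod.case)
    fix k m t assume "(k, m, t) \<in> admissible \<alpha>"
    from subpacketization_bounds(1)[OF q this] q
    show "subpacketization q k m t = real q powr g (k, m, t)"
      by (simp add: g_def)
  qed
  ultimately show
    "\<exists>g \<in> O[diff_to_infinity \<alpha>](\<lambda>(k, m, t). (log (real q) (num_users q k m t))\<^sup>2).
       \<forall>\<^sub>F (k, m, t) in diff_to_infinity \<alpha>.
         subpacketization q k m t = real q powr (g (k, m, t))"
    by blast
  show "(\<lambda>(k, m, t). rate q k m t) \<in> \<Theta>[diff_to_infinity \<alpha>](\<lambda>(k, m, t).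
      num_users q k m t / (log (real q) (num_users q k m t))\<^sup>2)"
  proof (rule bigthetaI')
    show "\<forall>\<^sub>F p in diff_to_infinity \<alpha>.
        1 / 4 * norm (case p of (k, m, t) \<Rightarrow>
          num_users q k m t / (log (real q) (num_users q k m t))\<^sup>2)
          \<le> norm (case p of (k, m, t) \<Rightarrow> rate q k m t) \<and>
        norm (case p of (k, m, t) \<Rightarrow> rate q k m t)
          \<le> 32 * (real \<alpha>)\<^sup>2 * norm (case p of (k, m, t) \<Rightarrow>
            num_users q k m t / (log (real q) (num_users q k m t))\<^sup>2)"
    proof (rule ev, unfold prod.case)
      fix k m t assume adm: "(k, m, t) \<in> admissible \<alpha>"
      define s where "s = num_users q k m t / (log (real q) (num_users q k m t))\<^sup>2"
      \<comment> \<open>Nonnegativity of \<open>s\<close>, and hence of the rate, reduces the norms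
        to the plain bounds.\<close>
      have "s \<ge> 0" using K[OF adm] by (simp add: s_def)
      moreover have "1 / 4 * s \<le> rate q k m t" "rate q k m t \<le> 32 * (real \<alpha>)\<^sup>2 * s"
        unfolding s_def by (rule rate_bounds[OF q assms(2) adm])+
      ultimately show "1 / 4 * norm s \<le> norm (rate q k m t) \<and>
          norm (rate q k m t) \<le> 32 * (real \<alpha>)\<^sup>2 * norm s"
        by simp
    qed
  qed (use assms(2) in simp_all)
qed

end
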